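(* Let $p$ be a prime, let $G=UT(4,p)$, and let $$\mathcal L_0^*=\{(a,b,c,0,e,f):(a,f)\in \mathbb F_p^2\setminus\{(0,0)\},\ b,c,e\in\mathbb F_p\}\subset G.$$ Then $$\alpha(\Gamma(G))=p^3-p+1+\alpha\bigl(\Gamma[\mathcal L_0^*]\bigr).$$
   Context: For a prime $p$, $UT(4,p)$ is the group, under matrix multiplication, of all $4\times 4$ upper triangular matrices over $\mathbb{F}_p$ with all diagonal entries equal to $1$. The $6$-tuple $(a,b,c,d,e,f)\in\mathbb{F}_p^6$ denotes the matrix $\begin{pmatrix}1&a&b&c\\0&1&d&e\\0&0&1&f\\0&0&0&1\end{pmatrix}$. The commuting graph $\Gamma(G)$ has vertex set $G$, two distinct vertices $x,y$ being adjacent if and only if $xy=yx$. For a subset $S\subseteq G$, $\Gamma[S]$ denotes the subgraph of $\Gamma(G)$ induced on $S$. The independence number $\alpha$ of a graph is the maximum size of a set of pairwise nonadjacent vertices. *)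

theory Defs
  imports
    "HOL-Algebra.Group"
    "Jordan_Normal_Form.Determinant"
    "Berlekamp_Zassenhaus.Finite_Field"
    "Graph_Theory.Graph_Theory"
begin

definition UT :: "nat \<Rightarrow> 'a::comm_ring_1 mat monoid" where
  "UT n = \<lparr>carrier = {A \<in> carrier_mat n n. upper_triangular A \<and> (\<forall>i<n. A $$ (i, i) = 1)},
           mult = (*), one = 1\<^sub>m n\<rparr>"

text \<open>
  A simple graph is a symmetric loop-free digraph in the sense of the locale \<^locale>\<open>graph\<close>:
  an edge between \<open>x\<close> and \<open>y\<close> is represented by the two arcs \<open>(x, y)\<close> and \<open>(y, x)\<close>.
\<close>

definition commuting_graph :: "('a, 'm) monoid_scheme \<Rightarrow> ('a, 'a \<times> 'a) pre_digraph" where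
  "commuting_graph G = with_proj
     \<lparr>pverts = carrier G,
      parcs = {(x, y). x \<in> carrier G \<and> y \<in> carrier G \<and> x \<noteq> y \<and> x \<otimes>\<^bsub>G\<^esub> y = y \<otimes>\<^bsub>G\<^esub> x}\<rparr>"

definition independent_set :: "('v, 'e) pre_digraph \<Rightarrow> 'v set \<Rightarrow> bool" where
  "independent_set \<Gamma> S \<longleftrightarrow>
     S \<subseteq> verts \<Gamma> \<and> (\<forall>x\<in>S. \<forall>y\<in>S. x \<noteq> y \<longrightarrow> \<not> x \<rightarrow>\<^bsub>\<Gamma>\<^esub> y)"

text \<open>Only meaningful for graphs with finitely many vertices.\<close>

definition independence_number :: "('v, 'e) pre_digraph \<Rightarrow> nat" where
  "independence_number \<Gamma> = Max (card ` {S. independent_set \<Gamma> S})"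

definition ut4 :: "'a::comm_ring_1 \<Rightarrow> 'a \<Rightarrow> 'a \<Rightarrow> 'a \<Rightarrow> 'a \<Rightarrow> 'a \<Rightarrow> 'a mat" where
  "ut4 a b c d e f = mat_of_rows_list 4
     [[1, a, b, c],
      [0, 1, d, e],
      [0, 0, 1, f],
      [0, 0, 0, 1]]"

definition L0_star :: "'a::comm_ring_1 mat set" where
  "L0_star = {ut4 a b c 0 e f | a b c e f. (a, f) \<noteq> (0, 0)}"

lemma graph_commuting_graph:
  assumes "finite (carrier G)"
  shows "graph (commuting_graph G)"
proof -
  have "finite {(x, y). x \<in> carrier G \<and> y \<in> carrier G \<and> x \<noteq> y \<and> x \<otimes>\<^bsub>G\<^esub> y = y \<otimes>\<^bsub>G\<^esub> x}"
    by (rule finite_subset[of _ "carrier G \<times> carrier G"]) (use assms in auto)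
  then have "pair_graph \<lparr>pverts = carrier G,
      parcs = {(x, y). x \<in> carrier G \<and> y \<in> carrier G \<and> x \<noteq> y \<and> x \<otimes>\<^bsub>G\<^esub> y = y \<otimes>\<^bsub>G\<^esub> x}\<rparr>"
    using assms by unfold_locales (auto simp: symmetric_def arcs_ends_def arc_to_ends_def intro!: symI)
  then show ?thesis
    unfolding commuting_graph_def by (rule pair_graph.pair_graphD_graph)
qed

lemma ut4_in_UT: "ut4 a b c d e f \<in> carrier (UT 4)"
  by (auto simp: ut4_def UT_def mat_of_rows_list_def upper_triangular_def
        less_Suc_eq numeral_eq_Suc)

lemma L0_star_subset: "L0_star \<subseteq> carrier (UT 4)"
  by (auto simp: L0_star_def ut4_in_UT)

lemma UT4_carrier: "carrier (UT 4) = {ut4 a b c d e f | a b c d e f. True}"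
proof -
  have "A = ut4 (A $$ (0,1)) (A $$ (0,2)) (A $$ (0,3)) (A $$ (1,2)) (A $$ (1,3)) (A $$ (2,3))"
    if "A \<in> carrier (UT 4)" for A :: "'a mat"
  proof (rule eq_matI)
    fix i j :: nat
    assume "i < dim_row (ut4 (A $$ (0,1)) (A $$ (0,2)) (A $$ (0,3)) (A $$ (1,2)) (A $$ (1,3)) (A $$ (2,3)))"
      and "j < dim_col (ut4 (A $$ (0,1)) (A $$ (0,2)) (A $$ (0,3)) (A $$ (1,2)) (A $$ (1,3)) (A $$ (2,3)))"
    then have "i \<in> {0, 1, 2, 3}" "j \<in> {0, 1, 2, 3}"
      by (auto simp: ut4_def mat_of_rows_list_def)
    moreover have "A $$ (i, i) = 1" if "i < 4" for i
      using that \<open>A \<in> carrier (UT 4)\<close> by (simp add: UT_def)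
    moreover have "A $$ (i, j) = 0" if "j < i" "i < 4" for i j
      using that \<open>A \<in> carrier (UT 4)\<close> by (auto simp: UT_def)
    ultimately show "A $$ (i, j) = ut4 (A $$ (0,1)) (A $$ (0,2)) (A $$ (0,3)) (A $$ (1,2))
        (A $$ (1,3)) (A $$ (2,3)) $$ (i, j)"
      by (auto simp: ut4_def mat_of_rows_list_def)
  qed (use that in \<open>auto simp: UT_def ut4_def mat_of_rows_list_def\<close>)
  then show ?thesis using ut4_in_UT by blast
qed

lemma ut4_mult:
  "ut4 a b c d e f * ut4 a' b' c' d' e' f' =
   ut4 (a + a') (b + a * d' + b') (c + a * e' + b * f' + c') (d + d') (e + d * f' + e') (f + f')"
  (is "?x * ?y = ?z")
proof (rule eq_matI)
  fix i j assume "i < dim_row ?z" "j < dim_col ?z"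
  then have ij: "i \<in> {0, 1, 2, 3}" "j \<in> {0, 1, 2, 3}"
    by (auto simp: ut4_def mat_of_rows_list_def)
  have "(?x * ?y) $$ (i, j) = (\<Sum>k\<in>{0, 1, 2, 3}. ?x $$ (i, k) * ?y $$ (k, j))"
  proof -
    have "{0..<4::nat} = {0, 1, 2, 3}" by auto
    with ij show ?thesis
      by (auto simp: ut4_def mat_of_rows_list_def scalar_prod_def)
  qed
  with ij show "(?x * ?y) $$ (i, j) = ?z $$ (i, j)"
    by (elim insertE emptyE) (simp_all add: ut4_def mat_of_rows_list_def ac_simps)
qed (simp_all add: ut4_def mat_of_rows_list_def)

lemma ut4_0: "ut4 0 0 0 0 0 0 = 1\<^sub>m 4"
proof (rule eq_matI)
  fix i j :: nat assume "i < dim_row (1\<^sub>m 4)" "j < dim_col (1\<^sub>m 4)"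
  then have "i \<in> {0, 1, 2, 3}" "j \<in> {0, 1, 2, 3}" by auto
  then show "ut4 0 0 0 0 0 0 $$ (i, j) = 1\<^sub>m 4 $$ (i, j)"
    by (elim insertE emptyE) (simp_all add: ut4_def mat_of_rows_list_def)
qed (simp_all add: ut4_def mat_of_rows_list_def)

lemma group_UT4: "group (UT 4 :: 'a::comm_ring_1 mat monoid)"
proof (rule groupI)
  fix x y z :: "'a mat"
  assume xyz: "x \<in> carrier (UT 4)" "y \<in> carrier (UT 4)" "z \<in> carrier (UT 4)"
  then show "x \<otimes>\<^bsub>UT 4\<^esub> y \<otimes>\<^bsub>UT 4\<^esub> z = x \<otimes>\<^bsub>UT 4\<^esub> (y \<otimes>\<^bsub>UT 4\<^esub> z)"
    by (auto simp: UT_def)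
next
  fix x y :: "'a mat"
  assume "x \<in> carrier (UT 4)" "y \<in> carrier (UT 4)"
  then obtain a b c d e f a' b' c' d' e' f'
    where "x = ut4 a b c d e f" "y = ut4 a' b' c' d' e' f'"
    unfolding UT4_carrier by blast
  then have "x * y \<in> carrier (UT 4)"
    using ut4_in_UT by (simp add: ut4_mult)
  then show "x \<otimes>\<^bsub>UT 4\<^esub> y \<in> carrier (UT 4)"
    by (simp add: UT_def)
next
  fix x :: "'a mat"
  assume "x \<in> carrier (UT 4)"
  then obtain a b c d e f where x: "x = ut4 a b c d e f"
    unfolding UT4_carrier by blast
  let ?y = "ut4 (- a) (a * d - b) (a * e + b * f - c - a * d * f) (- d) (d * f - e) (- f)"
  have "?y * x = 1\<^sub>m 4"
    unfolding x ut4_mult ut4_0[symmetric] by (simp add: algebra_simps)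
  then show "\<exists>y\<in>carrier (UT 4). y \<otimes>\<^bsub>UT 4\<^esub> x = \<one>\<^bsub>UT 4\<^esub>"
    using ut4_in_UT[of "- a" "a * d - b" "a * e + b * f - c - a * d * f" "- d" "d * f - e" "- f"]
    by (intro bexI[of _ ?y]) (simp_all add: UT_def)
qed (auto simp: UT_def)

end

theory Submission
  imports Defs
begin

text \<open>
  Two elements \<open>(a, b, c, d, e, f)\<close> and \<open>(a', b', c', d', e', f')\<close> commute exactly when
  \<open>a d' = a' d\<close>, \<open>d f' = d' f\<close> and \<open>a e' + b f' = a' e + b' f\<close>. If \<open>d\<close> and \<open>d'\<close> are nonzero,
  then the first two equations compare \<open>(a/d, f/d)\<close>, and given them the third compares
  \<open>(a e - b f)/d\<^sup>2\<close>. So commuting is an equivalence relation on the elements with \<open>d \<noteq> 0\<close>, and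
  its classes are indexed by the triples \<open>(u, v, t)\<close> in which \<open>u = v = 0\<close> forces \<open>t = 0\<close>; there
  are \<open>(q\<^sup>2 - 1) q + 1 = q\<^sup>3 - q + 1\<close> of them over a field with \<open>q\<close> elements.

  The remaining elements outside \<open>L0_star\<close> are those with \<open>a = d = f = 0\<close>. They may commute with
  members of several classes, but they can be added to the class with label \<open>(0, 0, 0)\<close>, because
  all elements with \<open>a = f = 0\<close> commute with each other. Hence the complement of \<open>L0_star\<close> is
  covered by \<open>q\<^sup>3 - q + 1\<close> cliques, and an independent set has at most one element in each of
  them besides its elements in \<open>L0_star\<close>. This bound is attained: take one element with \<open>d \<noteq> 0\<close>
  from each class. These commute neither with each other nor with an element of \<open>L0_star\<close>, for
  since \<open>d' = 0\<close> there, the first two equations would force \<open>a' = f' = 0\<close>.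

  The lemma \<open>independence_number_clique_cover_split\<close> is this counting argument for graphs;
  \<open>same_class_imp_commute\<close>, \<open>commute_imp_same_class\<close> and \<open>not_commute_L0_star\<close> verify its
  hypotheses.
\<close>

section \<open>Independence numbers and clique covers\<close>

lemma finite_independent_sets:
  assumes "finite (verts \<Gamma>)"
  shows "finite {S. independent_set \<Gamma> S}"
proof (rule finite_subset)
  show "{S. independent_set \<Gamma> S} \<subseteq> Pow (verts \<Gamma>)"
    by (auto simp: independent_set_def)
qed (simp add: assms)

lemma independent_set_card_le:
  assumes "finite (verts \<Gamma>)" "independent_set \<Gamma> S"
  shows "card S \<le> independence_number \<Gamma>"
  unfolding independence_number_def
  using finite_independent_sets[OF assms(1)] assms(2) by (intro Max_ge) auto

lemma independence_number_attained:
  assumes "finite (verts \<Gamma>)"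
  obtains S where "independent_set \<Gamma> S" "card S = independence_number \<Gamma>"
proof -
  have "independent_set \<Gamma> {}"
    by (simp add: independent_set_def)
  then have "independence_number \<Gamma> \<in> card ` {S. independent_set \<Gamma> S}"
    unfolding independence_number_def using finite_independent_sets[OF assms] by (intro Max_in) auto
  then show ?thesis using that by auto
qed

lemma independent_set_induce_subgraph_iff:
  assumes "B \<subseteq> verts \<Gamma>"
  shows "independent_set (\<Gamma> \<restriction> B) S \<longleftrightarrow> S \<subseteq> B \<and> independent_set \<Gamma> S"
proof -
  have "x \<rightarrow>\<^bsub>\<Gamma> \<restriction> B\<^esub> y \<longleftrightarrow> x \<rightarrow>\<^bsub>\<Gamma>\<^esub> y" if "x \<in> B" "y \<in> B" for x y
    using that by (auto simp: arcs_ends_def arc_to_ends_def)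
  with assms show ?thesis
    by (auto simp: independent_set_def subset_iff)
qed

text \<open>
  If the vertices outside \<open>B\<close> are partitioned into cliques, the fibres of \<open>k\<close>, then an independent
  set takes at most one of them from each clique. One vertex of \<open>R\<close> from each clique can be added
  to any independent subset of \<open>B\<close>, so the bound is attained. Vertices of different cliques may be
  adjacent as long as they are not both in \<open>R\<close>.
\<close>

lemma independence_number_clique_cover_split:
  assumes "graph \<Gamma>" and B: "B \<subseteq> verts \<Gamma>"
    and clique: "\<And>x y. \<lbrakk>x \<in> verts \<Gamma> - B; y \<in> verts \<Gamma> - B; x \<noteq> y; k x = k y\<rbrakk> \<Longrightarrow> x \<rightarrow>\<^bsub>\<Gamma>\<^esub> y"
    and R: "R \<subseteq> verts \<Gamma> - B" "k ` (verts \<Gamma> - B) = k ` R"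
    and separated: "\<And>x y. \<lbrakk>x \<in> R; y \<in> R; x \<rightarrow>\<^bsub>\<Gamma>\<^esub> y\<rbrakk> \<Longrightarrow> k x = k y"
    and isolated: "\<And>x z. \<lbrakk>x \<in> R; z \<in> B\<rbrakk> \<Longrightarrow> \<not> x \<rightarrow>\<^bsub>\<Gamma>\<^esub> z"
  shows "independence_number \<Gamma> = card (k ` R) + independence_number (\<Gamma> \<restriction> B)"
proof (rule antisym)
  interpret graph \<Gamma> by fact
  have finB: "finite (verts (\<Gamma> \<restriction> B))"
    using B finite_verts by (auto intro: finite_subset)
  have finR: "finite R"
    using R(1) finite_verts by (auto intro: finite_subset)
  obtain S where S: "independent_set \<Gamma> S" "card S = independence_number \<Gamma>"
    using independence_number_attained finite_verts by blast
  have finS: "finite S"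
    using S(1) finite_verts by (auto simp: independent_set_def intro: finite_subset)
  have "card (S \<inter> B) \<le> independence_number (\<Gamma> \<restriction> B)"
    using S(1) B finB
    by (intro independent_set_card_le)
       (auto simp: independent_set_induce_subgraph_iff, auto simp: independent_set_def)
  moreover have "card (S - B) \<le> card (k ` R)"
  proof (rule card_inj_on_le)
    show "inj_on k (S - B)"
    proof (rule inj_onI, rule ccontr)
      fix x y assume "x \<in> S - B" "y \<in> S - B" "k x = k y" "x \<noteq> y"
      with S(1) clique show False unfolding independent_set_def by blast
    qed
    show "k ` (S - B) \<subseteq> k ` R"
      unfolding R(2)[symmetric] using S(1) by (auto simp: independent_set_def)
    show "finite (k ` R)" using finR by simp
  qed
  moreover have "card S = card (S - B) + card (S \<inter> B)"
    using finS by (metis add.commute card_Int_Diff)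
  ultimately show "independence_number \<Gamma> \<le> card (k ` R) + independence_number (\<Gamma> \<restriction> B)"
    using S(2) by linarith

  obtain T where T: "independent_set (\<Gamma> \<restriction> B) T" "card T = independence_number (\<Gamma> \<restriction> B)"
    using independence_number_attained finB by blast
  then have TB: "T \<subseteq> B" and T_ind: "independent_set \<Gamma> T"
    using B by (auto simp: independent_set_induce_subgraph_iff)
  obtain U where U: "U \<subseteq> R" "inj_on k U" "k ` R = k ` U"
    using subset_image_inj[of "k ` R" k R] by blast
  have "independent_set \<Gamma> (U \<union> T)"
    unfolding independent_set_def
  proof (intro conjI ballI impI)
    show "U \<union> T \<subseteq> verts \<Gamma>" using U(1) R(1) TB B by blast
    fix x y assume xy: "x \<in> U \<union> T" "y \<in> U \<union> T" "x \<noteq> y"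
    consider "x \<in> U" "y \<in> U" | "x \<in> U" "y \<in> T" | "x \<in> T" "y \<in> U" | "x \<in> T" "y \<in> T"
      using xy by blast
    then show "\<not> x \<rightarrow>\<^bsub>\<Gamma>\<^esub> y"
    proof cases
      case 1
      with xy(3) U separated show ?thesis by (meson inj_onD subsetD)
    next
      case 2 with U(1) TB isolated show ?thesis by blast
    next
      case 3
      with U(1) TB isolated have "\<not> y \<rightarrow>\<^bsub>\<Gamma>\<^esub> x" by blast
      then show ?thesis using sym_arcs by (auto simp: symmetric_def dest: symD)
    next
      case 4 with T_ind xy(3) show ?thesis by (auto simp: independent_set_def)
    qed
  qed
  then have "card (U \<union> T) \<le> independence_number \<Gamma>"
    using independent_set_card_le finite_verts by blast
  moreover have "card (U \<union> T) = card U + card T"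
    using finR finB U(1) TB R(1) by (intro card_Un_disjoint) (auto intro: finite_subset)
  moreover have "card (k ` R) = card U"
    using U by (simp add: card_image)
  ultimately show "card (k ` R) + independence_number (\<Gamma> \<restriction> B) \<le> independence_number \<Gamma>"
    using T(2) by linarith
qed

lemma verts_commuting_graph [simp]: "verts (commuting_graph G) = carrier G"
  by (simp add: commuting_graph_def)

lemma commuting_graph_adj_iff:
  "x \<rightarrow>\<^bsub>commuting_graph G\<^esub> y \<longleftrightarrow>
     x \<in> carrier G \<and> y \<in> carrier G \<and> x \<noteq> y \<and> x \<otimes>\<^bsub>G\<^esub> y = y \<otimes>\<^bsub>G\<^esub> x"
  by (auto simp: commuting_graph_def arcs_ends_def arc_to_ends_def)

section \<open>Commuting classes of unitriangular matrices\<close>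

lemma ut4_entries [simp]:
  "ut4 a b c d e f $$ (0, Suc 0) = a" "ut4 a b c d e f $$ (0, 2) = b"
  "ut4 a b c d e f $$ (0, 3) = c" "ut4 a b c d e f $$ (Suc 0, 2) = d"
  "ut4 a b c d e f $$ (Suc 0, 3) = e" "ut4 a b c d e f $$ (2, 3) = f"
  by (simp_all add: ut4_def mat_of_rows_list_def)

lemma ut4_eq_iff:
  "ut4 a b c d e f = ut4 a' b' c' d' e' f' \<longleftrightarrow>
     a = a' \<and> b = b' \<and> c = c' \<and> d = d' \<and> e = e' \<and> f = f'"
  by (metis ut4_entries)

lemma ut4_commute_iff:
  "ut4 a b c d e f * ut4 a' b' c' d' e' f' = ut4 a' b' c' d' e' f' * ut4 a b c d e f \<longleftrightarrow>
     a * d' = a' * d \<and> d * f' = d' * f \<and> a * e' + b * f' = a' * e + b' * f"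
  by (auto simp: ut4_mult ut4_eq_iff algebra_simps)

lemma ut4_in_L0_star_iff: "ut4 a b c d e f \<in> L0_star \<longleftrightarrow> d = 0 \<and> (a, f) \<noteq> (0, 0)"
  by (auto simp: L0_star_def ut4_eq_iff)

text \<open>
  For \<open>d \<noteq> 0\<close> these are the invariants of the commuting class. Outside \<open>L0_star\<close>, an element with
  \<open>d = 0\<close> also has \<open>a = f = 0\<close>, and the convention \<open>x / 0 = 0\<close> gives it the label \<open>(0, 0, 0)\<close>, that
  of the elements with \<open>a = f = 0\<close> and \<open>d \<noteq> 0\<close>.
\<close>

definition commuting_class :: "'a::field mat \<Rightarrow> 'a \<times> 'a \<times> 'a" where
  "commuting_class A =
     (A $$ (0, 1) / A $$ (1, 2), A $$ (2, 3) / A $$ (1, 2),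
      (A $$ (0, 1) * A $$ (1, 3) - A $$ (0, 2) * A $$ (2, 3)) / (A $$ (1, 2))\<^sup>2)"

lemma commuting_class_ut4:
  "commuting_class (ut4 a b c d e f) = (a / d, f / d, (a * e - b * f) / d\<^sup>2)"
  by (simp add: commuting_class_def)

text \<open>
  Once \<open>u = a/d = a'/d'\<close> and \<open>v = f/d = f'/d'\<close>, the third commutation equation divided by \<open>d d'\<close>
  becomes \<open>u e'/d' - v b'/d' = u e/d - v b/d\<close>, whose two sides are the third components of the
  labels.
\<close>

lemma ut4_commute_iff_same_class:
  fixes a b c d e f a' b' c' d' e' f' :: "'a::field"
  assumes "d \<noteq> 0" "d' \<noteq> 0"
  shows "ut4 a b c d e f * ut4 a' b' c' d' e' f' = ut4 a' b' c' d' e' f' * ut4 a b c d e f \<longleftrightarrow>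
    commuting_class (ut4 a b c d e f) = commuting_class (ut4 a' b' c' d' e' f')"
proof -
  define u v where "u = a / d" and "v = f / d"
  have a: "a = u * d" and f: "f = v * d" using assms by (simp_all add: u_def v_def)
  have "a * d' = a' * d \<and> d * f' = d' * f \<longleftrightarrow> a' = u * d' \<and> f' = v * d'"
    using assms by (auto simp: a f)
  moreover have "u = a' / d' \<and> v = f' / d' \<longleftrightarrow> a' = u * d' \<and> f' = v * d'"
    using assms by (auto simp: field_simps)
  moreover have "a * e' + b * f' = a' * e + b' * f \<longleftrightarrow>
      (a * e - b * f) / d\<^sup>2 = (a' * e' - b' * f') / d'\<^sup>2"
    if a': "a' = u * d'" and f': "f' = v * d'"
  proof -
    have "a * e' + b * f' - (a' * e + b' * f) =
        d * d' * ((a' * e' - b' * f') / d'\<^sup>2 - (a * e - b * f) / d\<^sup>2)"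
      using assms by (simp add: a f a' f' field_simps power2_eq_square)
    with assms show ?thesis
      by (metis (no_types, lifting) eq_iff_diff_eq_0 mult_eq_0_iff)
  qed
  ultimately show ?thesis
    unfolding ut4_commute_iff commuting_class_ut4 prod.inject u_def[symmetric] v_def[symmetric]
    by blast
qed

lemma same_class_imp_commute:
  fixes x y :: "'a::field mat"
  assumes "x \<in> carrier (UT 4) - L0_star" "y \<in> carrier (UT 4) - L0_star"
    and same: "commuting_class x = commuting_class y"
  shows "x * y = y * x"
proof -
  obtain a b c d e f where x: "x = ut4 a b c d e f"
    using assms(1) unfolding UT4_carrier by blast
  obtain a' b' c' d' e' f' where y: "y = ut4 a' b' c' d' e' f'"
    using assms(2) unfolding UT4_carrier by blast
  have d0: "d = 0 \<longrightarrow> a = 0 \<and> f = 0" "d' = 0 \<longrightarrow> a' = 0 \<and> f' = 0"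
    using assms(1,2) by (auto simp: x y ut4_in_L0_star_iff)
  show ?thesis
  proof (cases "d = 0 \<or> d' = 0")
    case True
    with d0 same show ?thesis by (auto simp: x y ut4_commute_iff commuting_class_ut4)
  next
    case False
    with same show ?thesis by (simp add: x y ut4_commute_iff_same_class)
  qed
qed

text \<open>
  Here \<open>d \<noteq> 0\<close> is essential: for \<open>a = d = f = 0\<close> and \<open>d' \<noteq> 0\<close> the elements commute as soon as
  \<open>b f' = a' e\<close>, which does not make the label of the second one \<open>(0, 0, 0)\<close>.
\<close>

lemma commute_imp_same_class:
  fixes x y :: "'a::field mat"
  assumes "x \<in> {ut4 a b c d e f | a b c d e f. d \<noteq> 0}" "y \<in> {ut4 a b c d e f | a b c d e f. d \<noteq> 0}"
    and "x * y = y * x"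
  shows "commuting_class x = commuting_class y"
  using assms by (auto simp: ut4_commute_iff_same_class)

lemma not_commute_L0_star:
  fixes x z :: "'a::field mat"
  assumes "x \<in> {ut4 a b c d e f | a b c d e f. d \<noteq> 0}" "z \<in> L0_star"
  shows "x * z \<noteq> z * x"
  using assms by (auto simp: L0_star_def ut4_commute_iff)

text \<open>
  Solving \<open>u e - b v = t\<close> with the help of whichever of \<open>u\<close> and \<open>v\<close> is nonzero gives an element
  with \<open>d = 1\<close> in the class of label \<open>(u, v, t)\<close>. If both vanish, then \<open>t = 0\<close> and \<open>b = e = 0\<close> do.
\<close>

lemma commuting_class_representative:
  fixes u v t :: "'a::field"
  assumes "u = 0 \<and> v = 0 \<longrightarrow> t = 0"
  shows "\<exists>b e. commuting_class (ut4 u b 0 1 e v) = (u, v, t)"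
proof (cases "u = 0")
  case True
  with assms have "commuting_class (ut4 u (- t / v) 0 1 0 v) = (u, v, t)"
    by (cases "v = 0") (auto simp: commuting_class_ut4)
  then show ?thesis by blast
next
  case False
  then have "commuting_class (ut4 u 0 0 1 (t / u) v) = (u, v, t)"
    by (simp add: commuting_class_ut4)
  then show ?thesis by blast
qed

lemma commuting_class_in_labels:
  assumes "x \<in> carrier (UT 4) - L0_star"
  shows "commuting_class x \<in> {(u, v, t). u = 0 \<and> v = 0 \<longrightarrow> t = 0}"
  using assms by (auto simp: UT4_carrier ut4_in_L0_star_iff commuting_class_ut4)

lemma nonzero_d_subset:
  "{ut4 a b c d e f | a b c d e f. d \<noteq> 0} \<subseteq> carrier (UT 4) - L0_star"
  by (auto simp: ut4_in_UT ut4_in_L0_star_iff)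

lemma commuting_class_image:
  "commuting_class ` {ut4 a b c d e f | a b c d e f. d \<noteq> 0} =
     {(u, v, t :: 'a::field). u = 0 \<and> v = 0 \<longrightarrow> t = 0}"
proof
  show "commuting_class ` {ut4 a b c d e f | a b c d e f. d \<noteq> 0} \<subseteq>
      {(u, v, t :: 'a). u = 0 \<and> v = 0 \<longrightarrow> t = 0}"
    by (rule image_subsetI, rule commuting_class_in_labels, rule subsetD[OF nonzero_d_subset])
next
  show "{(u, v, t :: 'a). u = 0 \<and> v = 0 \<longrightarrow> t = 0} \<subseteq>
      commuting_class ` {ut4 a b c d e f | a b c d e f. d \<noteq> 0}"
  proof
    fix l :: "'a \<times> 'a \<times> 'a"
    assume "l \<in> {(u, v, t). u = 0 \<and> v = 0 \<longrightarrow> t = 0}"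
    then obtain u v t where l: "l = (u, v, t)" "u = 0 \<and> v = 0 \<longrightarrow> t = 0" by auto
    from commuting_class_representative[OF l(2)]
    obtain b e where "commuting_class (ut4 u b 0 1 e v) = l" unfolding l(1) by (elim exE)
    moreover have "ut4 u b 0 1 e v \<in> {ut4 a b c d e f | a b c d e f. d \<noteq> 0}"
      by (auto simp: ut4_eq_iff)
    ultimately show "l \<in> commuting_class ` {ut4 a b c d e f | a b c d e f. d \<noteq> 0}"
      by (rule image_eqI[OF sym])
  qed
qed

lemma card_commuting_class_labels:
  "card {(u :: 'a::{field, finite}, v :: 'a, t :: 'a). u = 0 \<and> v = 0 \<longrightarrow> t = 0} =
     CARD('a) ^ 3 - CARD('a) + 1"
proof -
  have labels: "{(u :: 'a, v :: 'a, t :: 'a). u = 0 \<and> v = 0 \<longrightarrow> t = 0} = UNIV - {0} \<times> {0} \<times> (UNIV - {0})"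
    by auto
  have "card (UNIV - {0 :: 'a} \<times> {0 :: 'a} \<times> (UNIV - {0 :: 'a})) =
      CARD('a \<times> 'a \<times> 'a) - card ({0 :: 'a} \<times> {0 :: 'a} \<times> (UNIV - {0 :: 'a}))"
    by (rule card_Diff_subset) simp_all
  moreover have "card ({0 :: 'a} \<times> {0 :: 'a} \<times> (UNIV - {0 :: 'a})) = CARD('a) - 1"
    by (simp add: card_cartesian_product card_Diff_subset)
  moreover have "CARD('a \<times> 'a \<times> 'a) = CARD('a) ^ 3"
    by (simp add: power3_eq_cube)
  moreover have "CARD('a) \<le> CARD('a) ^ 3" "0 < CARD('a)"
    by (simp_all add: self_le_power)
  ultimately show ?thesis unfolding labels by linarith
qed

section \<open>The independence number of the commuting graph\<close>

theorem independence_number_UT4: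
  "independence_number (commuting_graph (UT 4 :: 'a::{field, finite} mat monoid)) =
     CARD('a) ^ 3 - CARD('a) + 1 +
     independence_number (commuting_graph (UT 4 :: 'a mat monoid) \<restriction> L0_star)"
proof -
  let ?G = "UT 4 :: 'a mat monoid"
  have mult: "x \<otimes>\<^bsub>?G\<^esub> y = x * y" for x y by (simp add: UT_def)
  let ?R = "{ut4 a b c d e f | a b c d e f :: 'a. d \<noteq> 0}"
  have "carrier ?G \<subseteq> (\<lambda>(a, b, c, d, e, f). ut4 a b c d e f) ` UNIV"
  proof
    fix x :: "'a mat" assume "x \<in> carrier ?G"
    then obtain a b c d e f where "x = (\<lambda>(a, b, c, d, e, f). ut4 a b c d e f) (a, b, c, d, e, f)"
      unfolding UT4_carrier by auto
    then show "x \<in> (\<lambda>(a, b, c, d, e, f). ut4 a b c d e f) ` UNIV" by blast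
  qed
  then have "finite (carrier ?G)"
    by (rule finite_subset) simp
  then have "graph (commuting_graph ?G)"
    by (rule graph_commuting_graph)
  then have "independence_number (commuting_graph ?G) =
      card (commuting_class ` ?R) + independence_number (commuting_graph ?G \<restriction> L0_star)"
  proof (rule independence_number_clique_cover_split)
    show "L0_star \<subseteq> verts (commuting_graph ?G)"
      using L0_star_subset by simp
    show R: "?R \<subseteq> verts (commuting_graph ?G) - L0_star"
      using nonzero_d_subset by simp
    show "commuting_class ` (verts (commuting_graph ?G) - L0_star) = commuting_class ` ?R"
    proof
      show "commuting_class ` (verts (commuting_graph ?G) - L0_star) \<subseteq> commuting_class ` ?R"
        unfolding commuting_class_image by (rule image_subsetI, rule commuting_class_in_labels) simp
    qed (rule image_mono[OF R])
    show "x \<rightarrow>\<^bsub>commuting_graph ?G\<^esub> y"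
      if "x \<in> verts (commuting_graph ?G) - L0_star" "y \<in> verts (commuting_graph ?G) - L0_star"
        "x \<noteq> y" "commuting_class x = commuting_class y" for x y
      using that same_class_imp_commute[of x y] by (simp add: commuting_graph_adj_iff mult)
    show "commuting_class x = commuting_class y"
      if "x \<in> ?R" "y \<in> ?R" "x \<rightarrow>\<^bsub>commuting_graph ?G\<^esub> y" for x y
      using commute_imp_same_class[OF that(1,2)] that(3) by (simp add: commuting_graph_adj_iff mult)
    show "\<not> x \<rightarrow>\<^bsub>commuting_graph ?G\<^esub> z" if "x \<in> ?R" "z \<in> L0_star" for x z
      using not_commute_L0_star[OF that] by (simp add: commuting_graph_adj_iff mult)
  qed
  then show ?thesis
    unfolding commuting_class_image card_commuting_class_labels .
qed

theorem theorem6p4: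
  fixes p :: nat
  assumes "prime p" and "CARD('p::prime_card) = p"
  shows "independence_number (commuting_graph (UT 4 :: 'p mod_ring mat monoid)) =
    p ^ 3 - p + 1 +
    independence_number (commuting_graph (UT 4 :: 'p mod_ring mat monoid) \<restriction> L0_star)"
proof -
  have "CARD('p mod_ring) = p" using assms(2) by simp
  then show ?thesis using independence_number_UT4[where ?'a = "'p mod_ring"] by simp
qed

end
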